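(* For every integer $k\ge 2$ there exist a constant $c_k>0$ and a constant $C_k$ (depending only on $k$) such that for all integers $n>k$, $$\bigl|F_2(n,k)-c_k n\bigr|\le C_k,$$ i.e. $F_2(n,k)=c_k n+O_k(1)$.
   Context: $F_2(n,k)$ denotes the maximum number of edges in an $n$-vertex (simple, finite) graph containing no $(k+1)$-connected subgraph. Here a graph is $(k+1)$-connected if it has at least $k+2$ vertices and remains connected after the deletion of any $k$ vertices. *)

theory Defs
  imports Complex_Main
begin

type_synonym 'a graph = "'a set \<times> 'a set set"

abbreviation verts :: "'a graph \<Rightarrow> 'a set" where
  "verts G \<equiv> fst G"

abbreviation edges :: "'a graph \<Rightarrow> 'a set set" where
  "edges G \<equiv> snd G"

definition simple_graph :: "'a graph \<Rightarrow> bool" where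
  "simple_graph G \<longleftrightarrow> finite (verts G) \<and> (\<forall>e\<in>edges G. e \<subseteq> verts G \<and> card e = 2)"

text \<open>Subgraphs need not be induced.\<close>

definition subgraph_of :: "'a graph \<Rightarrow> 'a graph \<Rightarrow> bool" where
  "subgraph_of H G \<longleftrightarrow>
     simple_graph H \<and> verts H \<subseteq> verts G \<and> edges H \<subseteq> edges G"

definition delete_verts :: "'a graph \<Rightarrow> 'a set \<Rightarrow> 'a graph" where
  "delete_verts G S = (verts G - S, {e \<in> edges G. e \<inter> S = {}})"

definition graph_connected :: "'a graph \<Rightarrow> bool" where
  "graph_connected G \<longleftrightarrow> verts G \<noteq> {} \<and>
     (\<forall>u\<in>verts G. \<forall>v\<in>verts G. (u, v) \<in> {(x, y). {x, y} \<in> edges G}\<^sup>*)"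

text \<open>The parameter is shifted: \<open>Suc_connected k G\<close> says that \<open>G\<close> is \<open>(k+1)\<close>-connected.\<close>

definition Suc_connected :: "nat \<Rightarrow> 'a graph \<Rightarrow> bool" where
  "Suc_connected k G \<longleftrightarrow> k + 2 \<le> card (verts G) \<and>
     (\<forall>S. S \<subseteq> verts G \<and> card S = k \<longrightarrow> graph_connected (delete_verts G S))"

text \<open>Taking vertices in \<open>nat\<close> loses nothing, as every finite graph is isomorphic to such a graph.\<close>

definition admissible :: "nat \<Rightarrow> nat \<Rightarrow> nat graph set" where
  "admissible n k = {G. simple_graph G \<and> card (verts G) = n \<and>
     \<not> (\<exists>H. subgraph_of H G \<and> Suc_connected k H)}"

definition F2 :: "nat \<Rightarrow> nat \<Rightarrow> nat" where
  "F2 n k = Max ((\<lambda>G. card (edges G)) ` admissible n k)"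

text \<open>The maximum is over a finite nonempty set, so \<open>Max\<close> has its intended meaning.\<close>

lemma finite_edge_counts: "finite ((\<lambda>G. card (edges G)) ` admissible n k)"
proof -
  have "card (edges G) \<le> 2 ^ n" if "G \<in> admissible n k" for G
  proof -
    have "finite (verts G)" "edges G \<subseteq> Pow (verts G)" "card (verts G) = n"
      using that unfolding admissible_def simple_graph_def by blast+
    then show ?thesis
      using card_mono[of "Pow (verts G)" "edges G"] by (simp only: card_Pow finite_Pow_iff)
  qed
  then have "(\<lambda>G. card (edges G)) ` admissible n k \<subseteq> {..2 ^ n}"
    by blast
  then show ?thesis
    by (rule finite_subset) (rule finite_atMost)
qed

lemma admissible_nonempty: "admissible n k \<noteq> {}"
proof -
  have "\<not> Suc_connected k H" if H: "subgraph_of H ({..<n}, {})" for H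
  proof
    assume con: "Suc_connected k H"
    have fin: "finite (verts H)" and E: "edges H = {}"
      using H by (simp_all add: subgraph_of_def simple_graph_def)
    have le: "k + 2 \<le> card (verts H)"
      using con unfolding Suc_connected_def by blast
    obtain S where S: "S \<subseteq> verts H" "card S = k"
      by (rule obtain_subset_with_card_n[OF add_leD1[OF le]])
    have "card (verts H - S) = card (verts H) - k"
      using S card_Diff_subset[OF finite_subset[OF S(1) fin] S(1)] by simp
    then have "2 \<le> card (verts H - S)" using le by linarith
    then obtain T where T: "T \<subseteq> verts H - S" "card T = 2"
      by (rule obtain_subset_with_card_n)
    then obtain u v where T_eq: "T = {u, v}" and "u \<noteq> v"
      unfolding card_2_iff by blast
    have "graph_connected (delete_verts H S)"
      using con S unfolding Suc_connected_def by blast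
    moreover have "u \<in> verts (delete_verts H S)" "v \<in> verts (delete_verts H S)"
      using T T_eq by (simp_all add: delete_verts_def)
    ultimately have "(u, v) \<in> {(x, y). {x, y} \<in> edges (delete_verts H S)}\<^sup>*"
      unfolding graph_connected_def by blast
    moreover have "edges (delete_verts H S) = {}"
      by (simp add: delete_verts_def E)
    ultimately show False using \<open>u \<noteq> v\<close> by simp
  qed
  then have "({..<n}, {}) \<in> admissible n k"
    unfolding admissible_def simple_graph_def by simp
  then show ?thesis by blast
qed

end

theory Submission
  imports Defs "HOL-Library.Ramsey"
begin

text \<open>
  Call a graph free if it has no \<open>(k+1)\<close>-connected subgraph, and let \<open>c\<close> be the supremum of
  \<open>(e(G) - e(G[S])) / (|V(G)| - k)\<close> over free graphs \<open>G\<close> and \<open>k\<close>-sets \<open>S \<subset> V(G)\<close>.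
  If the supremum is attained by \<open>(G, S)\<close>, gluing copies of \<open>G\<close> along \<open>S\<close>, with the edges inside \<open>S\<close>
  removed, gives free graphs with \<open>c n - O(1)\<close> edges, while \<open>e(G) \<le> c (n - k) + e(G[S])\<close> for all free \<open>G\<close>.
  It is attained: otherwise the deficit \<open>c (|V(G)| - k) - e(G) + e(G[S])\<close> is positive, hence at least some
  \<open>\<delta> > 0\<close> on all pairs of bounded size. A free graph splits along a \<open>k\<close>-separator, the deficits being
  additive, and a large free graph has an independent \<open>k\<close>-set by Ramsey's theorem; so by induction the deficit
  grows at least linearly in \<open>|V(G)|\<close>, which contradicts the choice of \<open>c\<close>.
\<close>

section \<open>Free graphs and their induced subgraphs\<close>

definition free :: "nat \<Rightarrow> 'a set \<Rightarrow> 'a set set \<Rightarrow> bool" where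
  "free k V E \<longleftrightarrow> simple_graph (V, E) \<and> \<not> (\<exists>H. subgraph_of H (V, E) \<and> Suc_connected k H)"

definition inside :: "'a set set \<Rightarrow> 'a set \<Rightarrow> 'a set set" where
  "inside E A = {e \<in> E. e \<subseteq> A}"

lemma simple_graph_inside: "simple_graph (V, E) \<Longrightarrow> A \<subseteq> V \<Longrightarrow> simple_graph (A, inside E A)"
  by (auto simp: simple_graph_def inside_def intro: finite_subset)

lemma simple_graph_finite:
  assumes "simple_graph (V, E)"
  shows "finite V" "finite E" "card E \<le> 2 ^ card V"
proof -
  show V: "finite V" using assms by (simp add: simple_graph_def)
  have sub: "E \<subseteq> Pow V" using assms by (auto simp: simple_graph_def)
  show "finite E" using sub V by (meson finite_Pow_iff finite_subset)
  show "card E \<le> 2 ^ card V" using card_mono[OF _ sub] V by (simp add: card_Pow)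
qed

lemma freeD: "free k V E \<Longrightarrow> simple_graph (V, E)"
  by (simp add: free_def)

lemma free_mono:
  "free k V E \<Longrightarrow> V' \<subseteq> V \<Longrightarrow> E' \<subseteq> E \<Longrightarrow> simple_graph (V', E') \<Longrightarrow> free k V' E'"
  unfolding free_def subgraph_of_def by fastforce

lemma free_inside: "free k V E \<Longrightarrow> A \<subseteq> V \<Longrightarrow> free k A (inside E A)"
  by (rule free_mono[OF _ _ _ simple_graph_inside[OF freeD]]) (auto simp: inside_def)

lemma free_small:
  assumes "simple_graph (V, E)" "card V < k + 2"
  shows "free k V E"
proof -
  have "\<not> Suc_connected k H" if "subgraph_of H (V, E)" for H
  proof -
    have "card (verts H) \<le> card V"
      using that simple_graph_finite(1)[OF assms(1)] by (simp add: subgraph_of_def card_mono)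
    then show ?thesis using assms(2) by (simp add: Suc_connected_def)
  qed
  then show ?thesis using assms(1) by (auto simp: free_def)
qed

section \<open>Separating and gluing along at most k vertices\<close>

text \<open>Being a subgraph of itself, a free graph on at least k+2 vertices is disconnected by
  some k-set S. One side is a component of the rest together with S, the other is everything outside
  that component.\<close>

lemma free_separation:
  assumes "free k V E" "k + 2 \<le> card V"
  obtains A B where "A \<union> B = V" "card (A \<inter> B) = k" "A - B \<noteq> {}" "B - A \<noteq> {}"
    "E = inside E A \<union> inside E B"
proof -
  have sg: "simple_graph (V, E)" using assms(1) by (rule freeD)
  have "\<not> Suc_connected k (V, E)"
    using assms(1) sg unfolding free_def by (auto simp: subgraph_of_def)
  then obtain S where S: "S \<subseteq> V" "card S = k" and nc: "\<not> graph_connected (delete_verts (V, E) S)"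
    using assms(2) by (auto simp: Suc_connected_def)
  define R where "R = {(x, y). {x, y} \<in> edges (delete_verts (V, E) S)}"
  \<comment> \<open>\<open>graph_connected\<close> also fails on the empty vertex set; only after
    excluding this does its failure yield an unreachable pair.\<close>
  have "V - S \<noteq> {}"
    using S assms(2) card_mono[OF finite_subset[OF S(1) simple_graph_finite(1)[OF sg]], of V]
    by fastforce
  then obtain u v where uv: "u \<in> V - S" "v \<in> V - S" "(u, v) \<notin> R\<^sup>*"
    using nc by (auto simp: graph_connected_def delete_verts_def R_def)
  define U where "U = {w \<in> V - S. (u, w) \<in> R\<^sup>*}"
  show thesis
  proof
    show "(U \<union> S) \<union> (V - U) = V" using S by (auto simp: U_def)
    have "(U \<union> S) \<inter> (V - U) = S" using S by (auto simp: U_def)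
    then show "card ((U \<union> S) \<inter> (V - U)) = k" using S by simp
    show "(U \<union> S) - (V - U) \<noteq> {}" using uv by (auto simp: U_def)
    show "(V - U) - (U \<union> S) \<noteq> {}" using uv by (auto simp: U_def)
    \<comment> \<open>An edge violating both inclusions would join U to a vertex outside U and S, so
      that vertex would be reachable from u as well.\<close>
    have "e \<subseteq> U \<union> S \<or> e \<subseteq> V - U" if e: "e \<in> E" for e
    proof (rule ccontr)
      assume neg: "\<not> ?thesis"
      have eV: "e \<subseteq> V" "card e = 2" using e sg by (auto simp: simple_graph_def)
      then obtain x y where xy: "x \<in> e" "x \<in> U" "y \<in> e" "y \<notin> U \<union> S"
        using neg by auto
      then have "e = {x, y}"
        using eV(2) unfolding card_2_iff by (auto simp: U_def)
      then have "(x, y) \<in> R"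
        using e xy by (auto simp: R_def delete_verts_def U_def)
      then have "(u, y) \<in> R\<^sup>*" using xy(2) by (auto simp: U_def)
      then show False using xy eV by (auto simp: U_def)
    qed
    then show "E = inside E (U \<union> S) \<union> inside E (V - U)"
      by (auto simp: inside_def)
  qed
qed

text \<open>A (k+1)-connected subgraph must meet both B - A and A - B, for otherwise it lies in one
  free side. Since no edge joins these two differences, its vertices in the overlap separate it, and
  there are at most k of them.\<close>

lemma free_glue:
  assumes sg: "simple_graph (A \<union> B, E)" and E: "E \<subseteq> inside E A \<union> inside E B"
    and "card (A \<inter> B) \<le> k" and A: "free k A (inside E A)" and B: "free k B (inside E B)"
  shows "free k (A \<union> B) E"
proof -
  have False if H: "subgraph_of H (A \<union> B, E)" and con: "Suc_connected k H" for H
  proof -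
    have sH: "simple_graph H" "verts H \<subseteq> A \<union> B" "edges H \<subseteq> E"
      using H by (auto simp: subgraph_of_def)
    have fin: "finite (verts H)" "finite (A \<union> B)" using sH(1) sg by (auto simp: simple_graph_def)
    have "\<not> verts H \<subseteq> A"
    proof
      assume "verts H \<subseteq> A"
      then have "subgraph_of H (A, inside E A)"
        using sH by (fastforce simp: subgraph_of_def inside_def simple_graph_def)
      then show False using A con unfolding free_def by blast
    qed
    moreover have "\<not> verts H \<subseteq> B"
    proof
      assume "verts H \<subseteq> B"
      then have "subgraph_of H (B, inside E B)"
        using sH by (fastforce simp: subgraph_of_def inside_def simple_graph_def)
      then show False using B con unfolding free_def by blast
    qed
    ultimately obtain u v where uv: "u \<in> verts H" "u \<notin> A" "v \<in> verts H" "v \<notin> B" by auto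
    have "u \<noteq> v" using uv sH by auto
    have "card (A \<inter> B \<inter> verts H) \<le> k"
      using assms(3) card_mono[of "A \<inter> B" "A \<inter> B \<inter> verts H"] fin by fastforce
    moreover have "k \<le> card (verts H - {u, v})"
      using con uv \<open>u \<noteq> v\<close> by (auto simp: Suc_connected_def card_Diff_subset)
    moreover have "A \<inter> B \<inter> verts H \<subseteq> verts H - {u, v}" using uv by auto
    \<comment> \<open>\<open>Suc_connected\<close> speaks of deleting exactly k vertices, so the
      overlap is enlarged to a k-set that still avoids u and v.\<close>
    ultimately obtain S where S: "A \<inter> B \<inter> verts H \<subseteq> S" "S \<subseteq> verts H - {u, v}" "card S = k"
      using exists_subset_between fin(1) by (metis finite_Diff)
    define R where "R = {(x, y). {x, y} \<in> edges (delete_verts H S)}"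
    have "graph_connected (delete_verts H S)"
      using con S by (auto simp: Suc_connected_def)
    then have "(u, v) \<in> R\<^sup>*"
      using uv S(2) by (auto simp: graph_connected_def delete_verts_def R_def)
    \<comment> \<open>A walk that starts outside A and avoids S never enters A: an edge leaving a
      vertex outside A lies in B, so its other end could be in A only by being in the overlap, which
      S covers.\<close>
    then have "v \<notin> A"
    proof induction
      case (step y z)
      have yz: "{y, z} \<in> edges H" "y \<notin> S" "z \<notin> S"
        using step(2) by (auto simp: R_def delete_verts_def)
      then have "{y, z} \<subseteq> verts H" using sH(1) by (auto simp: simple_graph_def)
      moreover have "{y, z} \<subseteq> A \<or> {y, z} \<subseteq> B" using yz(1) sH(3) E by (auto simp: inside_def)
      ultimately show ?case using step.IH yz S(1) by auto
    qed (use uv in auto)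
    then show False using uv sH by auto
  qed
  then show ?thesis using sg unfolding free_def by blast
qed

section \<open>Transport along injective maps\<close>

lemma simple_graph_image:
  assumes "simple_graph (V, E)" "inj_on f V"
  shows "simple_graph (f ` V, (`) f ` E)"
proof -
  have "card (f ` e) = 2" if "e \<in> E" for e
    using that assms card_image[of f e] by (auto simp: simple_graph_def dest: inj_on_subset)
  then show ?thesis using assms by (auto simp: simple_graph_def)
qed

lemma Suc_connected_image:
  assumes sg: "simple_graph (V, E)" and inj: "inj_on g V" and con: "Suc_connected k (V, E)"
  shows "Suc_connected k (g ` V, (`) g ` E)"
proof -
  have "graph_connected (delete_verts (g ` V, (`) g ` E) S)" if S: "S \<subseteq> g ` V" "card S = k" for S
  proof -
    obtain T where T: "T \<subseteq> V" "S = g ` T" using S(1) by (auto simp: subset_image_iff)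
    then have "card T = k" using S(2) inj by (metis card_image inj_on_subset)
    then have c: "graph_connected (delete_verts (V, E) T)"
      using con T by (auto simp: Suc_connected_def)
    let ?R = "{(x, y). {x, y} \<in> edges (delete_verts (V, E) T)}"
    let ?R' = "{(x, y). {x, y} \<in> edges (delete_verts (g ` V, (`) g ` E) S)}"
    have edge: "(g x, g y) \<in> ?R'" if "(x, y) \<in> ?R" for x y
    proof -
      have xy: "{x, y} \<in> E" "x \<notin> T" "y \<notin> T" using that by (auto simp: delete_verts_def)
      then have "x \<in> V" "y \<in> V" using sg by (auto simp: simple_graph_def)
      then have "g x \<notin> S" "g y \<notin> S" using T inj xy by (auto dest: inj_onD)
      moreover have "{g x, g y} \<in> (`) g ` E" using imageI[OF xy(1), of "(`) g"] by simp
      ultimately show ?thesis by (simp add: delete_verts_def)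
    qed
    have step: "(g x, g y) \<in> ?R'\<^sup>*" if "(x, y) \<in> ?R\<^sup>*" for x y
      using that
    proof (induction rule: rtrancl_induct)
      case (step y z)
      then show ?case using edge by (meson rtrancl.rtrancl_into_rtrancl)
    qed simp
    have V': "g ` V - S = g ` (V - T)" using T inj by (auto dest: inj_onD)
    show ?thesis
      using c step unfolding graph_connected_def
      by (auto simp: delete_verts_def V' simp del: image_insert)
  qed
  then show ?thesis using con inj by (auto simp: Suc_connected_def card_image)
qed

text \<open>The inverse of f on V carries a (k+1)-connected subgraph of the image back to one of the
  original graph.\<close>

lemma free_image:
  assumes F: "free k V E" and inj: "inj_on f V"
  shows "free k (f ` V) ((`) f ` E)"
proof -
  define g where "g = the_inv_into V f"
  have gf: "g (f x) = x" if "x \<in> V" for x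
    using inj that by (simp add: g_def the_inv_into_f_f)
  have injg: "inj_on g (f ` V)" using gf by (auto intro!: inj_onI)
  have sg: "simple_graph (V, E)" using F by (rule freeD)
  have False if H: "subgraph_of H (f ` V, (`) f ` E)" and con: "Suc_connected k H" for H
  proof -
    obtain W D where HWD: "H = (W, D)" by (cases H)
    have s: "simple_graph (W, D)" "W \<subseteq> f ` V" "D \<subseteq> (`) f ` E"
      using H HWD by (auto simp: subgraph_of_def)
    have iW: "inj_on g W" using injg s(2) by (rule inj_on_subset)
    have "g ` W \<subseteq> V" using s(2) gf by auto
    moreover have "(`) g ` D \<subseteq> E"
    proof -
      have "g ` f ` e = e" if "e \<in> E" for e
      proof -
        have "e \<subseteq> V" using sg that by (auto simp: simple_graph_def)
        then show ?thesis using gf by (force simp: image_image)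
      qed
      then show ?thesis using s(3) by auto
    qed
    ultimately have "subgraph_of (g ` W, (`) g ` D) (V, E)"
      using simple_graph_image[OF s(1) iW] by (simp add: subgraph_of_def)
    moreover have "Suc_connected k (g ` W, (`) g ` D)"
      using Suc_connected_image[OF s(1) iW] con HWD by simp
    ultimately show False using F unfolding free_def by blast
  qed
  then show ?thesis using simple_graph_image[OF sg inj] unfolding free_def by blast
qed


text \<open>This is gluing with a one-vertex graph along the empty set. It serves to reach every
  number of vertices exactly.\<close>

lemma free_isolated:
  assumes F: "free k V E" and v: "v \<notin> V"
  shows "free k (insert v V) E"
proof -
  have sg: "simple_graph (V, E)" using F by (rule freeD)
  have eV: "e \<subseteq> V" if "e \<in> E" for e using that sg by (auto simp: simple_graph_def)
  have ne: "e \<noteq> {}" if "e \<in> E" for e using that sg by (auto simp: simple_graph_def)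
  have iV: "inside E V = E" and iv: "inside E {v} = {}"
    using eV ne v by (auto simp: inside_def)
  have "free k (V \<union> {v}) E"
  proof (rule free_glue)
    show "simple_graph (V \<union> {v}, E)" using sg by (auto simp: simple_graph_def)
    show "free k {v} (inside E {v})"
      by (rule free_small) (auto simp: iv simple_graph_def)
  qed (use F v iV in auto)
  then show ?thesis by simp
qed

section \<open>Independent k-sets from Ramsey's theorem\<close>

text \<open>A clique on k+2 vertices is (k+1)-connected, since deleting k of its vertices leaves an
  edge. So Ramsey's theorem must return its other alternative. With an independent root no edges are
  lost inside the root.\<close>

lemma free_imp_independent:
  "\<exists>r\<ge>1. \<forall>(V::'a set) E. free k V E \<and> r \<le> card V \<longrightarrow> (\<exists>S\<subseteq>V. card S = k \<and> inside E S = {})"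
proof -
  obtain r :: nat where r: "r \<ge> 1" "\<And>(V::'a set) E. finite V \<Longrightarrow> r \<le> card V \<Longrightarrow>
      \<exists>R\<subseteq>V. card R = k + 2 \<and> clique R E \<or> card R = k \<and> indep R E"
    using ramsey2[of "k + 2" k] by metis
  have "\<exists>S\<subseteq>V. card S = k \<and> inside E S = {}" if F: "free k V E" and "r \<le> card V" for V :: "'a set" and E
  proof -
    have sg: "simple_graph (V, E)" using F by (rule freeD)
    obtain R where R: "R \<subseteq> V" "card R = k + 2 \<and> clique R E \<or> card R = k \<and> indep R E"
      using r(2) simple_graph_finite(1)[OF sg] \<open>r \<le> card V\<close> by blast
    have "\<not> (card R = k + 2 \<and> clique R E)"
    proof
      assume cl: "card R = k + 2 \<and> clique R E"
      have "graph_connected (delete_verts (R, inside E R) S)" if S: "S \<subseteq> R" "card S = k" for S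
      proof -
        have "R \<noteq> S" using cl S by auto
        then have "R - S \<noteq> {}" using S by auto
        moreover have "(u, v) \<in> {(x, y). {x, y} \<in> edges (delete_verts (R, inside E R) S)}\<^sup>*"
          if "u \<in> R - S" "v \<in> R - S" for u v
        proof (cases "u = v")
          case False
          then have "{u, v} \<in> E" using cl that by (auto simp: clique_def)
          then show ?thesis using that by (auto simp: inside_def delete_verts_def)
        qed simp
        ultimately show ?thesis unfolding graph_connected_def by (auto simp: delete_verts_def)
      qed
      then have "Suc_connected k (R, inside E R)" using cl by (auto simp: Suc_connected_def)
      moreover have "subgraph_of (R, inside E R) (V, E)"
        using simple_graph_inside[OF sg R(1)] R(1) by (auto simp: subgraph_of_def inside_def)
      ultimately show False using F unfolding free_def by blast
    qed
    then have ind: "card R = k" "indep R E" using R(2) by auto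
    have "e \<notin> inside E R" for e
    proof
      assume e: "e \<in> inside E R"
      then have "card e = 2" using sg by (auto simp: inside_def simple_graph_def)
      then obtain x y where "e = {x, y}" "x \<noteq> y" by (auto simp: card_2_iff)
      then show False using e ind(2) by (auto simp: inside_def indep_def)
    qed
    then show ?thesis using R(1) ind(1) by blast
  qed
  then show ?thesis using r(1) by blast
qed

section \<open>Edge counts across a separation\<close>

text \<open>Inclusion-exclusion on a separation. The vertex identity says that the size |V| - k is
  additive, which is why densities are measured against it.\<close>

lemma free_split:
  assumes F: "free k V E" and "k + 2 \<le> card V"
  obtains A B where "A \<subseteq> V" "B \<subseteq> V" "card (A \<inter> B) = k" "k < card A" "k < card B"
    "card A + card B = card V + k"
    "card E + card (inside E (A \<inter> B)) = card (inside E A) + card (inside E B)"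
proof -
  obtain A B where AB: "A \<union> B = V" "card (A \<inter> B) = k" "A - B \<noteq> {}" "B - A \<noteq> {}"
    and E: "E = inside E A \<union> inside E B"
    by (rule free_separation[OF assms])
  have fin: "finite V" "finite E" using simple_graph_finite[OF freeD[OF F]] by auto
  have finAB: "finite A" "finite B" using fin AB(1) by auto
  show thesis
  proof
    show "A \<subseteq> V" "B \<subseteq> V" "card (A \<inter> B) = k" using AB by auto
    have "A \<inter> B \<subset> A" "A \<inter> B \<subset> B" using AB by auto
    then show "k < card A" "k < card B" using finAB psubset_card_mono AB(2) by metis+
    show "card A + card B = card V + k" using card_Un_Int[OF finAB] AB by simp
    have "inside E (A \<inter> B) = inside E A \<inter> inside E B" by (auto simp: inside_def)
    moreover have "finite (inside E A)" "finite (inside E B)" using fin(2) by (auto simp: inside_def)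
    ultimately show "card E + card (inside E (A \<inter> B)) = card (inside E A) + card (inside E B)"
      using card_Un_Int[of "inside E A" "inside E B"] E by simp
  qed
qed

text \<open>A crude bound that makes the supremum of densities finite. The induction uses that |V| -
  k is additive under splitting; the constant is the bound by the number of vertex subsets in the
  base case of k+1 vertices.\<close>

lemma free_linear_bound:
  "free k V E \<Longrightarrow> k < card V \<Longrightarrow> card E \<le> 2 ^ (k + 1) * (card V - k)"
proof (induction "card V" arbitrary: V E rule: less_induct)
  case less
  show ?case
  proof (cases "k + 2 \<le> card V")
    case False
    then have "card V = k + 1" using less.prems by simp
    then show ?thesis using simple_graph_finite(3)[OF freeD[OF less.prems(1)]] by simp
  next
    case True
    then obtain A B where AB: "A \<subseteq> V" "B \<subseteq> V" "k < card A" "k < card B"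
      "card A + card B = card V + k"
      "card E + card (inside E (A \<inter> B)) = card (inside E A) + card (inside E B)"
      using free_split[OF less.prems(1)] by metis
    have "card (inside E A) \<le> 2 ^ (k + 1) * (card A - k)"
      by (rule less.hyps) (use AB free_inside[OF less.prems(1)] in auto)
    moreover have "card (inside E B) \<le> 2 ^ (k + 1) * (card B - k)"
      by (rule less.hyps) (use AB free_inside[OF less.prems(1)] in auto)
    moreover have "card V - k = (card A - k) + (card B - k)" using AB by simp
    ultimately show ?thesis using AB(6) by (simp add: distrib_left)
  qed
qed

section \<open>Gluing copies along a root\<close>

text \<open>Each step glues a fresh copy of V - S to W along S. Keeping S free of edges makes the
  copies edge-disjoint, so the edge counts add up exactly; the induction starts from the edgeless
  graph on S.\<close>

lemma free_copies:
  fixes V :: "nat set"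
  assumes F: "free k V E" and S: "S \<subseteq> V" "card S = k"
  shows "\<exists>W D. free k W D \<and> S \<subseteq> W \<and> card W = k + j * (card V - k) \<and>
    card D = j * card (E - inside E S) \<and> inside D S = {}"
proof (induction j)
  case 0
  have "free k S {}"
    using S finite_subset[OF S(1) simple_graph_finite(1)[OF freeD[OF F]]]
    by (intro free_small) (auto simp: simple_graph_def)
  then show ?case using S by (intro exI[of _ S] exI[of _ "{}"]) (auto simp: inside_def)
next
  case (Suc j)
  then obtain W D where W: "free k W D" "S \<subseteq> W" "card W = k + j * (card V - k)"
    "card D = j * card (E - inside E S)" "inside D S = {}" by blast
  define E0 where "E0 = E - inside E S"
  have sg: "simple_graph (V, E)" "simple_graph (W, D)" using F W by (auto dest: freeD)
  have fin: "finite V" "finite E" "finite W" "finite D" "finite S"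
    using simple_graph_finite[OF sg(1)] simple_graph_finite[OF sg(2)] S(1) by (auto intro: finite_subset)
  have F0: "free k V E0"
    by (rule free_mono[OF F]) (use sg in \<open>auto simp: E0_def simple_graph_def\<close>)
  have "infinite (- W)" using fin(3) by (simp add: Compl_eq_Diff_UNIV)
  then obtain T where T: "finite T" "card T = card (V - S)" "T \<subseteq> - W"
    using infinite_arbitrarily_large by blast
  obtain h where h: "bij_betw h (V - S) T"
    using finite_same_card_bij[of "V - S" T] fin T by auto
  \<comment> \<open>The embedding fixes the root and sends all other vertices to T, outside W, so
    that the new copy meets W exactly in S.\<close>
  define f where "f x = (if x \<in> S then x else h x)" for x
  have fT: "f x \<in> T" if "x \<in> V - S" for x
    using that bij_betwE[OF h] by (auto simp: f_def)
  have fS: "f x = x" if "x \<in> S" for x using that by (simp add: f_def)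
  have inj: "inj_on f V"
  proof (rule inj_onI)
    fix x y assume xy: "x \<in> V" "y \<in> V" "f x = f y"
    show "x = y"
    proof (cases "x \<in> S \<or> y \<in> S")
      case True
      then show ?thesis using xy fS fT T(3) W(2) by (metis ComplD DiffI subsetD)
    next
      case False
      then show ?thesis using xy bij_betw_imp_inj_on[OF h] by (auto simp: f_def inj_on_def)
    qed
  qed
  have fW: "x \<in> S" if "x \<in> V" "f x \<in> W" for x
    using that fT T(3) by auto
  have WV: "W \<inter> f ` V = S"
    using fW fS S(1) W(2) by force
  define E1 where "E1 = (`) f ` E0"
  have F1: "free k (f ` V) E1" unfolding E1_def by (rule free_image[OF F0 inj])
  have sg1: "simple_graph (f ` V, E1)" using F1 by (rule freeD)
  have E1S: "\<not> e \<subseteq> S" if e: "e \<in> E1" for e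
  proof
    assume "e \<subseteq> S"
    obtain d where d: "d \<in> E0" "e = f ` d" using e by (auto simp: E1_def)
    then have "d \<subseteq> V" using sg by (auto simp: E0_def simple_graph_def)
    then have "d \<subseteq> S" using d(2) \<open>e \<subseteq> S\<close> fW W(2) by auto
    then show False using d(1) by (auto simp: E0_def inside_def)
  qed
  have DS: "\<not> e \<subseteq> S" if "e \<in> D" for e using W(5) that by (auto simp: inside_def)
  have DW: "e \<subseteq> W" if "e \<in> D" for e using sg(2) that by (auto simp: simple_graph_def)
  have EV: "e \<subseteq> f ` V" if "e \<in> E1" for e using sg1 that by (auto simp: simple_graph_def)
  \<comment> \<open>The two vertex sets share only S, and neither edge set has an edge inside S; so
    each edge belongs to exactly one side.\<close>
  have inW: "inside (D \<union> E1) W = D" and inV: "inside (D \<union> E1) (f ` V) = E1"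
    and disj: "D \<inter> E1 = {}"
    using DS DW EV E1S WV unfolding inside_def by blast+
  have "free k (W \<union> f ` V) (D \<union> E1)"
  proof (rule free_glue)
    show "simple_graph (W \<union> f ` V, D \<union> E1)" using sg(2) sg1 by (auto simp: simple_graph_def)
  qed (use inW inV W F1 WV S in auto)
  moreover have "card (W \<union> f ` V) = k + Suc j * (card V - k)"
  proof -
    have "card (W \<union> f ` V) + k = card W + card V"
      using card_Un_Int[of W "f ` V"] fin WV S card_image[OF inj] by simp
    moreover have "k \<le> card V" using S fin card_mono by metis
    ultimately show ?thesis using W(3) by simp
  qed
  moreover have "card (D \<union> E1) = Suc j * card (E - inside E S)"
  proof -
    have "E0 \<subseteq> Pow V" using sg by (auto simp: E0_def simple_graph_def)
    then have "inj_on ((`) f) E0" using inj_on_image_Pow[OF inj] by (rule inj_on_subset[rotated])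
    then have "card E1 = card E0" unfolding E1_def by (rule card_image)
    then show ?thesis
      using card_Un_disjoint[of D E1] fin disj W(4) by (simp add: E0_def E1_def)
  qed
  moreover have "inside (D \<union> E1) S = {}" using DS E1S by (auto simp: inside_def)
  ultimately show ?case using W(2) by blast
qed

section \<open>The optimal density and its attainment\<close>

text \<open>The pairs over which the density supremum is taken; strictness in
  \<open>k < card V\<close> keeps the denominator positive.\<close>

definition rooted :: "nat \<Rightarrow> 'a set \<Rightarrow> 'a set set \<Rightarrow> 'a set \<Rightarrow> bool" where
  "rooted k V E S \<longleftrightarrow> free k V E \<and> S \<subseteq> V \<and> card S = k \<and> k < card V"

lemma card_outside:
  "finite E \<Longrightarrow> card E = card (inside E S) + card (E - inside E S)"
  by (metis Diff_disjoint Diff_partition card_Un_disjoint finite_Diff finite_subset inside_def mem_Collect_eq subsetI)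

text \<open>Attainment is what gives a bounded error: pairs that merely approach the supremum would
  only determine the edge count up to o(n).\<close>

lemma optimal_density_attained:
  assumes k: "1 \<le> k"
  obtains V :: "nat set" and E S c where "rooted k V E S" "0 < c"
    "real (card (E - inside E S)) = c * real (card V - k)"
    "\<And>(V' :: nat set) E' S'. rooted k V' E' S' \<Longrightarrow> real (card (E' - inside E' S')) \<le> c * real (card V' - k)"
proof -
  define R where "R = {real (card (E - inside E S)) / real (card V - k) | (V :: nat set) E S. rooted k V E S}"
  define c where "c = Sup R"
  have bdd: "bdd_above R"
  proof (rule bdd_aboveI)
    fix x assume "x \<in> R"
    then obtain V E S where x: "x = real (card (E - inside E S)) / real (card (V :: nat set) - k)"
      and VES: "rooted k V E S" by (auto simp: R_def)
    have "card (E - inside E S) \<le> card E"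
      using VES simple_graph_finite(2) by (auto simp: rooted_def intro!: card_mono dest!: freeD)
    also have "\<dots> \<le> 2 ^ (k + 1) * (card V - k)"
      using VES free_linear_bound by (auto simp: rooted_def)
    finally have "real (card (E - inside E S)) \<le> real (2 ^ (k + 1) * (card V - k))"
      by (simp only: of_nat_le_iff)
    then show "x \<le> 2 ^ (k + 1)" using VES x by (simp add: rooted_def divide_le_eq)
  qed
  have le: "real (card (E - inside E S)) \<le> c * real (card V - k)"
    if "rooted k V E S" for V :: "nat set" and E S
  proof -
    have "real (card (E - inside E S)) / real (card V - k) \<le> c"
      unfolding c_def by (rule cSup_upper[OF _ bdd]) (use that in \<open>auto simp: R_def\<close>)
    then show ?thesis using that by (simp add: rooted_def divide_le_eq)
  qed
  \<comment> \<open>A single edge leaving the root \<open>{..<k}\<close> on k+1 vertices has density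
    1, hence c is at least 1.\<close>
  define E\<^sub>0 :: "nat set set" where "E\<^sub>0 = {{0, k}}"
  have "free k {..k} E\<^sub>0"
    by (rule free_small) (use k in \<open>auto simp: simple_graph_def E\<^sub>0_def\<close>)
  then have r0: "rooted k {..k} E\<^sub>0 {..<k}" by (auto simp: rooted_def)
  have "E\<^sub>0 - inside E\<^sub>0 {..<k} = E\<^sub>0" by (auto simp: inside_def E\<^sub>0_def)
  then have "0 < c" using le[OF r0] by (simp add: E\<^sub>0_def)
  have "\<exists>(V :: nat set) E S. rooted k V E S \<and> real (card (E - inside E S)) = c * real (card V - k)"
  proof (rule ccontr)
    assume neg: "\<not> ?thesis"
    have less: "real (card (E - inside E S)) < c * real (card V - k)"
      if "rooted k V E S" for V :: "nat set" and E S
      using le[OF that] neg that by fastforce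
    obtain M where M: "M \<ge> 1" "\<And>(V :: nat set) E. free k V E \<Longrightarrow> M \<le> card V \<Longrightarrow>
        \<exists>S\<subseteq>V. card S = k \<and> inside E S = {}"
      using free_imp_independent[of k] by metis
    \<comment> \<open>By \<open>le\<close>, Q bounds the edges outside the root when |V| - k is at
      most 2M. So X contains every positive deficit of such pairs.\<close>
    define Q where "Q = nat \<lfloor>c * real (2 * M)\<rfloor>"
    define X where "X = {x \<in> (\<lambda>(m, q). c * real m - real q) ` ({..2 * M} \<times> {..Q}). 0 < x}"
    \<comment> \<open>The element 1 only keeps the minimum defined should X be empty.\<close>
    define \<delta> where "\<delta> = Min (insert 1 X)"
    have finX: "finite X" by (simp add: X_def)
    have "0 < \<delta>" using finX by (simp add: \<delta>_def X_def)
    \<comment> \<open>On pairs of bounded size the deficit takes only finitely many values.\<close>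
    have gap: "real (card (E - inside E S)) \<le> c * real (card V - k) - \<delta>"
      if VES: "rooted k V E S" and small: "card V - k \<le> 2 * M" for V :: "nat set" and E S
    proof -
      let ?q = "card (E - inside E S)"
      have "c * real (card V - k) \<le> c * real (2 * M)"
        using small \<open>0 < c\<close> by (intro mult_left_mono) (simp_all only: of_nat_le_iff less_imp_le)
      then have "real ?q \<le> c * real (2 * M)" using le[OF VES] by linarith
      then have "?q \<le> Q" unfolding Q_def by linarith
      then have "c * real (card V - k) - real ?q \<in> X"
        using less[OF VES] small unfolding X_def
        by (intro CollectI conjI image_eqI[of _ _ "(card V - k, ?q)"])
          (use VES in \<open>simp_all add: rooted_def of_nat_diff\<close>)
      then have "\<delta> \<le> c * real (card V - k) - real ?q" using finX by (simp add: \<delta>_def)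
      then show ?thesis by linarith
    qed
    \<comment> \<open>The gap \<delta> is spread over 2M vertices: one application of
      \<open>gap\<close> pays \<alpha> for each unit of size up to 2M.\<close>
    define \<alpha> where "\<alpha> = \<delta> / (2 * real M)"
    have "0 < \<alpha>" using \<open>0 < \<delta>\<close> M(1) by (simp add: \<alpha>_def)
    have \<alpha>: "\<alpha> * real m \<le> \<delta>" if "m \<le> 2 * M" for m
    proof -
      have "\<alpha> * real m \<le> \<alpha> * real (2 * M)"
        using that \<open>0 < \<alpha>\<close> by (intro mult_left_mono) (simp_all only: of_nat_le_iff less_imp_le)
      also have "\<dots> = \<delta>" using M(1) by (simp add: \<alpha>_def)
      finally show ?thesis .
    qed
    \<comment> \<open>Sizes from M to 2M are the base case, with an independent root supplied by
      Ramsey. Larger graphs are split, and then at least one piece again has size at least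
      M.\<close>
    have large: "real (card E) \<le> (c - \<alpha>) * real (card V - k)"
      if "free k V E" "M \<le> card V - k" for V :: "nat set" and E
      using that
    proof (induction "card V" arbitrary: V E rule: less_induct)
      case (less V E)
      show ?case
      proof (cases "card V - k \<le> 2 * M")
        case True
        obtain S where S: "S \<subseteq> V" "card S = k" "inside E S = {}"
          using M(2)[OF less.prems(1) le_trans[OF less.prems(2) diff_le_self]] by blast
        then have "rooted k V E S" using less.prems M(1) by (auto simp: rooted_def)
        then have "real (card E) \<le> c * real (card V - k) - \<delta>" using gap[OF _ True] S(3) by fastforce
        then show ?thesis using \<alpha>[OF True] by (simp add: algebra_simps)
      next
        case False
        then have "k + 2 \<le> card V" using M(1) by linarith
        then obtain A B where AB: "A \<subseteq> V" "B \<subseteq> V" "card (A \<inter> B) = k" "k < card A" "k < card B"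
          "card A + card B = card V + k"
          "card E + card (inside E (A \<inter> B)) = card (inside E A) + card (inside E B)"
          using free_split[OF less.prems(1)] by metis
        have AB': "free k A (inside E A)" "free k B (inside E B)"
          using free_inside[OF less.prems(1)] AB by auto
        have sum: "real (card V - k) = real (card A - k) + real (card B - k)"
          using AB by linarith
        have IH: "real (card (inside E U)) \<le> (c - \<alpha>) * real (card U - k)"
          if "U \<in> {A, B}" "M \<le> card U - k" for U
          using less.hyps[of U "inside E U"] that AB AB' by auto
        \<comment> \<open>A piece below size M is outside the induction, so it is rooted at the
          separator. This costs the edges inside the separator, which \<open>edges\<close> pays back
          exactly once; one such piece is affordable.\<close>
        have small: "real (card (inside E U)) \<le> c * real (card U - k) - \<delta> + real (card (inside E (A \<inter> B)))"
          if "U \<in> {A, B}" "\<not> M \<le> card U - k" for U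
        proof -
          have "rooted k U (inside E U) (A \<inter> B)"
            using that AB AB' by (auto simp: rooted_def)
          moreover have "inside (inside E U) (A \<inter> B) = inside E (A \<inter> B)"
            using that by (auto simp: inside_def)
          moreover have "finite (inside E U)"
            using that simple_graph_finite(2) AB'[THEN freeD] by auto
          ultimately show ?thesis
            using gap[of U "inside E U" "A \<inter> B"] card_outside[of "inside E U" "A \<inter> B"] that by auto
        qed
        have edges: "real (card E) + real (card (inside E (A \<inter> B))) =
            real (card (inside E A)) + real (card (inside E B))"
          using AB(7) by linarith
        have expand: "(c - \<alpha>) * real (card V - k) = c * real (card A - k) - \<alpha> * real (card A - k)
            + (c * real (card B - k) - \<alpha> * real (card B - k))"
          by (simp only: sum left_diff_distrib distrib_left)
        \<comment> \<open>The sizes of the pieces add up to more than 2M, so they cannot both be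
          below M.\<close>
        consider "M \<le> card A - k" "M \<le> card B - k" | "M \<le> card A - k" "\<not> M \<le> card B - k"
          | "\<not> M \<le> card A - k" "M \<le> card B - k"
          using False sum by linarith
        then show ?thesis
        proof cases
          case 1
          then show ?thesis using IH[of A] IH[of B] edges expand by (simp add: left_diff_distrib)
        next
          case 2
          then have "real (card (inside E A)) \<le> c * real (card A - k) - \<alpha> * real (card A - k)"
            using IH[of A] by (simp only: left_diff_distrib insertI1)
          moreover have "\<alpha> * real (card B - k) \<le> \<delta>" using 2 by (intro \<alpha>) linarith
          ultimately show ?thesis using small[of B] 2 edges expand by auto
        next
          case 3
          then have "real (card (inside E B)) \<le> c * real (card B - k) - \<alpha> * real (card B - k)"
            using IH[of B] by (simp only: left_diff_distrib insertI1 insertI2)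
          moreover have "\<alpha> * real (card A - k) \<le> \<delta>" using 3 by (intro \<alpha>) linarith
          ultimately show ?thesis using small[of A] 3 edges expand by auto
        qed
      qed
    qed
    \<comment> \<open>The improved density c - \<alpha> holds for all rooted pairs, by
      \<open>large\<close> from size M on and by \<open>gap\<close> below, so it bounds the supremum
      c.\<close>
    have "c \<le> c - \<alpha>" unfolding c_def
    proof (rule cSup_least)
      show "R \<noteq> {}" using r0 by (auto simp: R_def)
      fix x assume "x \<in> R"
      then obtain V E S where x: "x = real (card (E - inside E S)) / real (card (V :: nat set) - k)"
        and VES: "rooted k V E S" by (auto simp: R_def)
      have F: "free k V E" "k < card V" using VES by (auto simp: rooted_def)
      have "real (card (E - inside E S)) \<le> (c - \<alpha>) * real (card V - k)"
      proof (cases "M \<le> card V - k")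
        case True
        have "card (E - inside E S) \<le> card E"
          using simple_graph_finite(2)[OF freeD[OF F(1)]] by (intro card_mono) auto
        then show ?thesis using large[OF F(1) True] by linarith
      next
        case False
        then show ?thesis using gap[OF VES] \<alpha>[of "card V - k"] by (simp add: algebra_simps)
      qed
      then show "x \<le> Sup R - \<alpha>" using F x by (simp add: divide_le_eq c_def)
    qed
    then show False using \<open>0 < \<alpha>\<close> by simp
  qed
  then show thesis using that \<open>0 < c\<close> le by blast
qed

section \<open>From the optimal density to F2\<close>

lemma free_add_isolated:
  fixes V :: "nat set"
  assumes "free k V E"
  shows "\<exists>W. free k W E \<and> card W = card V + r"
proof (induction r)
  case (Suc r)
  then obtain W where W: "free k W E" "card W = card V + r" by blast
  have "finite W" by (rule simple_graph_finite(1)[OF freeD[OF W(1)]])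
  moreover obtain v where "v \<notin> W" using ex_new_if_finite[OF infinite_UNIV_nat \<open>finite W\<close>] by blast
  ultimately show ?case using free_isolated[OF W(1)] W(2) by (intro exI[of _ "insert v W"]) auto
qed (use assms in auto)

lemma admissible_iff_free: "(V, E) \<in> admissible n k \<longleftrightarrow> free k V E \<and> card V = n"
  by (auto simp: admissible_def free_def)

lemma card_le_F2: "free k (V :: nat set) E \<Longrightarrow> card E \<le> F2 (card V) k"
  unfolding F2_def by (rule Max_ge[OF finite_edge_counts], rule image_eqI[of _ _ "(V, E)"])
    (simp_all add: admissible_iff_free)

lemma F2_attained: obtains V :: "nat set" and E where "free k V E" "card V = n" "card E = F2 n k"
proof -
  have "F2 n k \<in> (\<lambda>G. card (edges G)) ` admissible n k"
    unfolding F2_def using Max_in[OF finite_edge_counts] admissible_nonempty by blast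
  then obtain V E where "(V, E) \<in> admissible n k" "F2 n k = card E" by auto
  then show thesis by (auto simp: admissible_iff_free intro: that)
qed

theorem mainTheorem2:
  fixes k :: nat
  assumes "k \<ge> 2"
  shows "\<exists>c C :: real. c > 0 \<and> (\<forall>n::nat. n > k \<longrightarrow> \<bar>real (F2 n k) - c * real n\<bar> \<le> C)"
proof -
  have "1 \<le> k" using assms by simp
  then obtain V\<^sub>0 :: "nat set" and E\<^sub>0 S\<^sub>0 c where opt: "rooted k V\<^sub>0 E\<^sub>0 S\<^sub>0" and "0 < c"
    and eq: "real (card (E\<^sub>0 - inside E\<^sub>0 S\<^sub>0)) = c * real (card V\<^sub>0 - k)"
    and le: "\<And>(V :: nat set) E S. rooted k V E S \<Longrightarrow> real (card (E - inside E S)) \<le> c * real (card V - k)"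
    by (rule optimal_density_attained) blast
  define m where "m = card V\<^sub>0 - k"
  have "0 < m" using opt by (simp add: m_def rooted_def)
  \<comment> \<open>With n - k = j m + r, glue j copies of the optimal graph and add r isolated
    vertices. The loss against c n is c (k + r), where r < m.\<close>
  have lower: "c * real n - c * real (k + m) \<le> real (F2 n k)" if "k < n" for n
  proof -
    define j r where "j = (n - k) div m" and "r = (n - k) mod m"
    have n: "n = k + j * m + r" using that by (simp add: j_def r_def)
    obtain W :: "nat set" and D where W: "free k W D" "card W = k + j * m" "card D = j * card (E\<^sub>0 - inside E\<^sub>0 S\<^sub>0)"
      using free_copies[of k V\<^sub>0 E\<^sub>0 S\<^sub>0 j] opt unfolding rooted_def m_def by blast
    obtain W' :: "nat set" where W': "free k W' D" "card W' = n"
      using free_add_isolated[OF W(1), of r] W(2) n by auto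
    have "real (card D) = c * real (j * m)" using W(3) eq by (simp add: m_def)
    moreover have "real (card D) \<le> real (F2 n k)" using card_le_F2[OF W'(1)] W'(2) by simp
    moreover have "c * real r \<le> c * real m"
      using \<open>0 < m\<close> \<open>0 < c\<close> by (simp add: r_def less_imp_le)
    ultimately show ?thesis by (simp add: n algebra_simps)
  qed
  have upper: "real (F2 n k) \<le> c * real n + 2 ^ k" if n: "k < n" for n
  proof -
    obtain V :: "nat set" and E where VE: "free k V E" "card V = n" "card E = F2 n k"
      by (rule F2_attained)
    \<comment> \<open>Any k-subset of an extremal graph serves as root; the edges inside it number
      at most 2^k and go into the error term.\<close>
    obtain S where S: "S \<subseteq> V" "card S = k"
      using obtain_subset_with_card_n[of k V] VE(2) n by auto
    have "card (inside E S) \<le> 2 ^ k"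
      using simple_graph_finite(3)[OF simple_graph_inside[OF freeD[OF VE(1)] S(1)]] S(2) by simp
    then have "real (card (inside E S)) \<le> 2 ^ k" by (metis of_nat_le_iff of_nat_numeral of_nat_power)
    moreover have "real (card (E - inside E S)) \<le> c * real (n - k)"
      using le[of V E S] VE S n by (simp add: rooted_def)
    moreover have "c * real (n - k) \<le> c * real n" using \<open>0 < c\<close> by simp
    ultimately show ?thesis
      using card_outside[OF simple_graph_finite(2)[OF freeD[OF VE(1)]], of S] VE(3) by linarith
  qed
  have "\<bar>real (F2 n k) - c * real n\<bar> \<le> c * real (k + m) + 2 ^ k" if "k < n" for n
  proof -
    have "0 \<le> c * real (k + m)" "(0::real) \<le> 2 ^ k" using \<open>0 < c\<close> by simp_all
    then show ?thesis using lower[OF that] upper[OF that] by linarith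
  qed
  then show ?thesis using \<open>0 < c\<close> by blast
qed

end
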